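(* Let $\mathfrak A$ be a finite-dimensional unital associative algebra over $\mathbb C$. The characteristic polynomial of the entire algebra is quasi-invariant under the coadjoint action: for every invertible $g\in\mathfrak A$ and every $F\in\mathfrak A^*$, $$\chi(\lambda,\mu,\mathrm{Ad}^*_gF)=(\det \mathrm{Ad}_g)^{-2}\,\chi(\lambda,\mu,F).$$
   Context: Fix a basis $\{e_i\}$ of $\mathfrak A$, let $A_F$ be the matrix $(F(e_ie_j))_{i,j}$, and let $\chi(\lambda,\mu,F)=\det(\lambda A_F+\mu A_F^T)$ (the same basis is used on both sides). $\mathrm{Ad}_g:\mathfrak A\to\mathfrak A$ is $x\mapsto gxg^{-1}$, and $(\mathrm{Ad}^*_gF)(x)=F(g^{-1}xg)$. *)

theory Defs
  imports Complex_Main "Jordan_Normal_Form.Determinant"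
begin

text \<open>
  The algebra is the whole type. The sort is \<open>{ring, monoid_mult}\<close> rather than \<open>ring_1\<close>
  because \<open>ring_1\<close> includes \<open>0 \<noteq> 1\<close> and would exclude the zero algebra.
\<close>

locale fd_complex_algebra = vector_space scale
  for scale :: "complex \<Rightarrow> 'a \<Rightarrow> 'a::{ring, monoid_mult}" +
  assumes mult_scale_left: "scale c x * y = scale c (x * y)"
    and mult_scale_right: "x * scale c y = scale c (x * y)"
    and finite_dimensional: "\<exists>B. finite B \<and> span B = UNIV"

definition is_basis :: "(complex \<Rightarrow> 'a \<Rightarrow> 'a::ab_group_add) \<Rightarrow> nat \<Rightarrow> (nat \<Rightarrow> 'a) \<Rightarrow> bool" where
  "is_basis scale n e \<longleftrightarrow>
     inj_on e {..<n} \<and> module.independent scale (e ` {..<n}) \<and> module.span scale (e ` {..<n}) = UNIV"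

text \<open>Column \<open>j\<close> of the matrix of \<open>f\<close> holds the coordinates of \<open>f (e j)\<close>.\<close>

definition matrix_of_endo ::
    "(complex \<Rightarrow> 'a \<Rightarrow> 'a::ab_group_add) \<Rightarrow> nat \<Rightarrow> (nat \<Rightarrow> 'a) \<Rightarrow> ('a \<Rightarrow> 'a) \<Rightarrow> complex mat" where
  "matrix_of_endo scale n e f =
     mat n n (\<lambda>(i, j). module.representation scale (e ` {..<n}) (f (e j)) (e i))"

text \<open>
  The value that the determinant of the matrix of \<open>f\<close> takes in every basis. It exists for linear \<open>f\<close>
  on a finite-dimensional space, see \<open>endo_det_eq\<close> below.
\<close>

definition endo_det :: "(complex \<Rightarrow> 'a \<Rightarrow> 'a::ab_group_add) \<Rightarrow> ('a \<Rightarrow> 'a) \<Rightarrow> complex" where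
  "endo_det scale f = (THE d. \<forall>n e. is_basis scale n e \<longrightarrow> d = det (matrix_of_endo scale n e f))"

text \<open>Two-sided invertibility; the library's \<open>is_unit\<close> presupposes a commutative ring.\<close>

definition invertible_elem :: "'a::monoid_mult \<Rightarrow> bool" where
  "invertible_elem g \<longleftrightarrow> (\<exists>h. g * h = 1 \<and> h * g = 1)"

definition inverse_elem :: "'a::monoid_mult \<Rightarrow> 'a" where
  "inverse_elem g = (THE h. g * h = 1 \<and> h * g = 1)"

definition Ad :: "'a::monoid_mult \<Rightarrow> 'a \<Rightarrow> 'a" where
  "Ad g x = g * x * inverse_elem g"

definition coAd :: "'a::monoid_mult \<Rightarrow> ('a \<Rightarrow> complex) \<Rightarrow> 'a \<Rightarrow> complex" where
  "coAd g F x = F (inverse_elem g * x * g)"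

definition form_matrix :: "nat \<Rightarrow> (nat \<Rightarrow> 'a::times) \<Rightarrow> ('a \<Rightarrow> complex) \<Rightarrow> complex mat" where
  "form_matrix n e F = mat n n (\<lambda>(i, j). F (e i * e j))"

definition char_fun ::
    "nat \<Rightarrow> (nat \<Rightarrow> 'a::times) \<Rightarrow> complex \<Rightarrow> complex \<Rightarrow> ('a \<Rightarrow> complex) \<Rightarrow> complex" where
  "char_fun n e l m F = det (l \<cdot>\<^sub>m form_matrix n e F + m \<cdot>\<^sub>m transpose_mat (form_matrix n e F))"

lemma inverse_elem_eq:
  assumes "g * h = 1" "h * g = 1"
  shows "inverse_elem g = h"
  unfolding inverse_elem_def
proof (rule the_equality)
  fix k assume "g * k = 1 \<and> k * g = 1"
  then have "k = k * (g * h)" "k * g = 1" using assms by simp_all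
  then show "k = h" by (simp add: mult.assoc[symmetric])
qed (use assms in simp)

context fd_complex_algebra
begin

lemma is_basis_exists: "\<exists>n e. is_basis scale n e"
proof -
  obtain B where B: "finite B" "span B = UNIV" using finite_dimensional by blast
  obtain C where C: "C \<subseteq> B" "independent C" "B \<subseteq> span C"
    using maximal_independent_subset[of B] by metis
  then have "finite C" using B finite_subset by blast
  then obtain e where e: "bij_betw e {..<card C} C"
    using ex_bij_betw_nat_finite[of C] by (auto simp: atLeast0LessThan)
  have "span C = UNIV" using B C span_minimal[OF C(3) subspace_span] by auto
  then have "is_basis scale (card C) e"
    using e C by (auto simp: is_basis_def bij_betw_def)
  then show ?thesis by blast
qed

lemma is_basis_expand:
  assumes "is_basis scale n e"
  shows "v = (\<Sum>i<n. scale (representation (e ` {..<n}) v (e i)) (e i))"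
proof -
  have inj: "inj_on e {..<n}" and ind: "independent (e ` {..<n})"
    and sp: "span (e ` {..<n}) = UNIV"
    using assms by (auto simp: is_basis_def)
  have "(\<Sum>b\<in>e ` {..<n}. scale (representation (e ` {..<n}) v b) b) = v"
    by (rule sum_representation_eq) (use ind sp in auto)
  then show ?thesis by (simp add: sum.reindex[OF inj])
qed

lemma is_basis_coord:
  assumes b: "is_basis scale n e" and i: "i < n"
  shows "representation (e ` {..<n}) (\<Sum>j\<in>J. scale (a j) (w j)) (e i)
       = (\<Sum>j\<in>J. a j * representation (e ` {..<n}) (w j) (e i))"
proof -
  have ind: "independent (e ` {..<n})" and sp: "span (e ` {..<n}) = UNIV"
    using b by (auto simp: is_basis_def)
  show ?thesis
    by (simp add: representation_sum[OF ind] representation_scale[OF ind] sp)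
qed

lemma is_basis_coord_self:
  assumes b: "is_basis scale n e" and i: "i < n" "j < n"
  shows "representation (e ` {..<n}) (e j) (e i) = (if i = j then 1 else 0)"
proof -
  have ind: "independent (e ` {..<n})" and inj: "inj_on e {..<n}"
    using b by (auto simp: is_basis_def)
  show ?thesis
    using i inj by (auto simp: representation_basis[OF ind] inj_on_def)
qed

lemma is_basis_size:
  assumes "is_basis scale n e"
  shows "n = dim UNIV"
proof -
  have "card (e ` {..<n}) = n"
    using assms by (auto simp: is_basis_def card_image)
  moreover have "card (e ` {..<n}) = dim UNIV"
    using assms by (intro basis_card_eq_dim) (auto simp: is_basis_def)
  ultimately show ?thesis by simp
qed

lemma matrix_of_endo_mult:
  assumes b: "is_basis scale n b" and c: "is_basis scale n c"
    and lin: "Vector_Spaces.linear scale scale f"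
  shows "mat n n (\<lambda>(i, j). representation (c ` {..<n}) (f (b j)) (c i))
       = mat n n (\<lambda>(i, j). representation (c ` {..<n}) (b j) (c i)) * matrix_of_endo scale n b f"
    and "mat n n (\<lambda>(i, j). representation (c ` {..<n}) (f (b j)) (c i))
       = matrix_of_endo scale n c f * mat n n (\<lambda>(i, j). representation (c ` {..<n}) (b j) (c i))"
proof -
  interpret f: Vector_Spaces.linear scale scale f by (rule lin)
  have 1: "representation (c ` {..<n}) (f (b j)) (c i)
    = (\<Sum>k<n. representation (b ` {..<n}) (f (b j)) (b k) * representation (c ` {..<n}) (b k) (c i))"
    if "i < n" for i j
    by (subst is_basis_expand[OF b, of "f (b j)"]) (rule is_basis_coord[OF c that])
  have 2: "representation (c ` {..<n}) (f (b j)) (c i)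
    = (\<Sum>k<n. representation (c ` {..<n}) (b j) (c k) * representation (c ` {..<n}) (f (c k)) (c i))"
    if "i < n" for i j
  proof -
    have "f (b j) = (\<Sum>k<n. scale (representation (c ` {..<n}) (b j) (c k)) (f (c k)))"
      by (subst is_basis_expand[OF c, of "b j"]) (simp add: f.sum f.scale)
    then show ?thesis by (simp only: is_basis_coord[OF c that])
  qed
  show "mat n n (\<lambda>(i, j). representation (c ` {..<n}) (f (b j)) (c i))
       = mat n n (\<lambda>(i, j). representation (c ` {..<n}) (b j) (c i)) * matrix_of_endo scale n b f"
    by (rule eq_matI)
      (auto simp: 1 matrix_of_endo_def scalar_prod_def atLeast0LessThan mult.commute intro!: sum.cong)
  show "mat n n (\<lambda>(i, j). representation (c ` {..<n}) (f (b j)) (c i))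
       = matrix_of_endo scale n c f * mat n n (\<lambda>(i, j). representation (c ` {..<n}) (b j) (c i))"
    by (rule eq_matI)
      (auto simp: 2 matrix_of_endo_def scalar_prod_def atLeast0LessThan mult.commute intro!: sum.cong)
qed

lemma det_matrix_of_endo_unique:
  assumes b: "is_basis scale n b" and c: "is_basis scale m c"
    and lin: "Vector_Spaces.linear scale scale f"
  shows "det (matrix_of_endo scale n b f) = det (matrix_of_endo scale m c f)"
proof -
  have nm: "m = n" using is_basis_size[OF b] is_basis_size[OF c] by simp
  note c = c[unfolded nm]
  define P where "P = mat n n (\<lambda>(i, j). representation (c ` {..<n}) (b j) (c i))"
  define Q where "Q = mat n n (\<lambda>(i, j). representation (b ` {..<n}) (c j) (b i))"
  have P: "P \<in> carrier_mat n n" and Q: "Q \<in> carrier_mat n n" by (auto simp: P_def Q_def)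
  have M: "matrix_of_endo scale n e f \<in> carrier_mat n n" for e by (simp add: matrix_of_endo_def)
  have "P * Q = 1\<^sub>m n"
  proof (rule eq_matI)
    fix i j assume "i < dim_row (1\<^sub>m n :: complex mat)" "j < dim_col (1\<^sub>m n :: complex mat)"
    then have ij: "i < n" "j < n" by auto
    have "representation (c ` {..<n}) (c j) (c i)
      = (\<Sum>k<n. representation (b ` {..<n}) (c j) (b k) * representation (c ` {..<n}) (b k) (c i))"
      by (subst is_basis_expand[OF b, of "c j"]) (rule is_basis_coord[OF c ij(1)])
    then show "(P * Q) $$ (i, j) = 1\<^sub>m n $$ (i, j)"
      using ij is_basis_coord_self[OF c ij] by (simp add: P_def Q_def scalar_prod_def
          atLeast0LessThan mult.commute)
  qed (auto simp: P_def Q_def)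
  then have "det P * det Q = 1" using det_mult[OF P Q] by simp
  then have "det P \<noteq> 0" by auto
  moreover have "P * matrix_of_endo scale n b f = matrix_of_endo scale n c f * P"
    using matrix_of_endo_mult[OF b c lin] by (simp add: P_def)
  then have "det P * det (matrix_of_endo scale n b f) = det (matrix_of_endo scale n c f) * det P"
    using det_mult[OF P M] det_mult[OF M P] by metis
  ultimately show ?thesis by (simp add: nm)
qed

lemma endo_det_eq:
  assumes b: "is_basis scale n e" and lin: "Vector_Spaces.linear scale scale f"
  shows "endo_det scale f = det (matrix_of_endo scale n e f)"
  unfolding endo_det_def
  by (rule the_equality) (use b det_matrix_of_endo_unique[OF _ _ lin] in blast)+

end

end

theory Submission
  imports Defs
begin

text \<open>
  For a linear functional \<open>G\<close>, the matrix of \<open>G (e i * e j)\<close> is the Gram matrix of the bilinear form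
  \<open>G (x * y)\<close>. A multiplicative linear map \<open>\<phi>\<close> with matrix \<open>B\<close> turns the form of \<open>G\<close> into the form
  of \<open>G \<circ> \<phi>\<close> by substituting \<open>\<phi> x\<close> and \<open>\<phi> y\<close> for \<open>x\<close> and \<open>y\<close>, so the Gram matrix of \<open>G \<circ> \<phi>\<close> is
  \<open>B\<^sup>T A B\<close>, where \<open>A\<close> is that of \<open>G\<close> (\<open>form_matrix_comp\<close>). The congruence \<open>X \<mapsto> B\<^sup>T X B\<close> is linear and commutes
  with transposition, so it also carries the pencil \<open>l A + m A\<^sup>T\<close> of \<open>G\<close> to the pencil of \<open>G \<circ> \<phi>\<close>,
  and determinants get multiplied by \<open>(det B)\<^sup>2\<close> (\<open>char_fun_comp\<close>).

  Conjugation by \<open>g\<close> is an algebra automorphism, and \<open>F\<close> is the composition of its coadjoint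
  transform with \<open>Ad g\<close>. Hence \<open>\<chi> F\<close> is \<open>(det (Ad g))\<^sup>2\<close> times \<open>\<chi> (coAd g F)\<close>, and this factor can be
  moved to the other side because conjugation by the inverse of \<open>g\<close> inverts the matrix of \<open>Ad g\<close>.
\<close>

context fd_complex_algebra
begin

text \<open>
  Needed to see that the matrix of \<open>Ad g\<close> is invertible, so that its determinant may be divided by.
\<close>

lemma matrix_of_endo_comp:
  assumes b: "is_basis scale n e" and f: "Vector_Spaces.linear scale scale f"
  shows "matrix_of_endo scale n e (f \<circ> h) = matrix_of_endo scale n e f * matrix_of_endo scale n e h"
proof -
  interpret f: Vector_Spaces.linear scale scale f by (rule f)
  have "representation (e ` {..<n}) (f (h (e j))) (e i)
      = (\<Sum>k<n. representation (e ` {..<n}) (h (e j)) (e k) * representation (e ` {..<n}) (f (e k)) (e i))"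
    if "i < n" for i j
  proof -
    have "f (h (e j)) = (\<Sum>k<n. scale (representation (e ` {..<n}) (h (e j)) (e k)) (f (e k)))"
      by (subst is_basis_expand[OF b, of "h (e j)"]) (simp add: f.sum f.scale)
    then show ?thesis by (simp only: is_basis_coord[OF b that])
  qed
  then show ?thesis
    by (intro eq_matI)
      (auto simp: matrix_of_endo_def scalar_prod_def atLeast0LessThan mult.commute intro!: sum.cong)
qed

lemma matrix_of_endo_id:
  assumes b: "is_basis scale n e"
  shows "matrix_of_endo scale n e id = 1\<^sub>m n"
  by (rule eq_matI) (auto simp: matrix_of_endo_def is_basis_coord_self[OF b])

lemma linear_Ad: "Vector_Spaces.linear scale scale (Ad g)"
  unfolding Vector_Spaces.linear_def module_hom_def module_hom_axioms_def Ad_def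
  by (simp add: vector_space_axioms module_axioms algebra_simps mult_scale_left mult_scale_right)

text \<open>
  Multiplicativity makes \<open>G (\<phi> (x * y))\<close> the value of the form of \<open>G\<close> at \<open>\<phi> x\<close> and \<open>\<phi> y\<close>. In coordinates
  this is the usual congruence, with \<open>B\<^sup>T\<close> on the left because column \<open>j\<close> of \<open>B\<close> represents \<open>\<phi> (e j)\<close>.
\<close>

lemma form_matrix_comp:
  assumes b: "is_basis scale n e"
    and G: "Vector_Spaces.linear scale (*) G"
    and mult: "\<And>x y. \<phi> (x * y) = \<phi> x * \<phi> y"
  defines "B \<equiv> matrix_of_endo scale n e \<phi>"
  shows "form_matrix n e (G \<circ> \<phi>) = transpose_mat B * form_matrix n e G * B"
proof (rule eq_matI)
  interpret G: Vector_Spaces.linear scale "(*)" G by (rule G)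
  let ?r = "\<lambda>j k. representation (e ` {..<n}) (\<phi> (e j)) (e k)"
  fix i j assume "i < dim_row (transpose_mat B * form_matrix n e G * B)"
    and "j < dim_col (transpose_mat B * form_matrix n e G * B)"
  then have ij: "i < n" "j < n" by (auto simp: B_def matrix_of_endo_def)
  have "\<phi> (e i) * \<phi> (e j) = (\<Sum>k<n. scale (?r i k) (e k)) * (\<Sum>k<n. scale (?r j k) (e k))"
    by (intro arg_cong2[of _ _ _ _ "(*)"] is_basis_expand[OF b])
  also have "\<dots> = (\<Sum>k<n. \<Sum>k'<n. scale (?r i k * ?r j k') (e k * e k'))"
    by (simp add: sum_product mult_scale_left mult_scale_right mult.commute)
  finally have "G (\<phi> (e i) * \<phi> (e j)) = (\<Sum>k<n. \<Sum>k'<n. ?r i k * ?r j k' * G (e k * e k'))"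
    by (simp add: G.sum G.scale)
  also have "\<dots> = (\<Sum>k'<n. \<Sum>k<n. ?r i k * ?r j k' * G (e k * e k'))"
    by (rule sum.swap)
  also have "\<dots> = (\<Sum>k'<n. (\<Sum>k<n. ?r i k * G (e k * e k')) * ?r j k')"
    unfolding sum_distrib_right by (simp only: mult_ac)
  finally have "G (\<phi> (e i) * \<phi> (e j)) = (\<Sum>k'<n. (\<Sum>k<n. ?r i k * G (e k * e k')) * ?r j k')" .
  with ij show "form_matrix n e (G \<circ> \<phi>) $$ (i, j) = (transpose_mat B * form_matrix n e G * B) $$ (i, j)"
    by (simp add: form_matrix_def B_def matrix_of_endo_def scalar_prod_def atLeast0LessThan mult)
qed (auto simp: form_matrix_def B_def matrix_of_endo_def)

text \<open>
  The transpose of \<open>B\<^sup>T A B\<close> is \<open>B\<^sup>T A\<^sup>T B\<close>, so one congruence transforms both terms of the pencil; each of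
  its two outer factors contributes \<open>det B\<close>.
\<close>

lemma char_fun_comp:
  assumes b: "is_basis scale n e"
    and G: "Vector_Spaces.linear scale (*) G"
    and mult: "\<And>x y. \<phi> (x * y) = \<phi> x * \<phi> y"
  shows "char_fun n e l m (G \<circ> \<phi>) = (det (matrix_of_endo scale n e \<phi>))\<^sup>2 * char_fun n e l m G"
proof -
  define B where "B = matrix_of_endo scale n e \<phi>"
  define A where "A = form_matrix n e G"
  have B: "B \<in> carrier_mat n n" and A: "A \<in> carrier_mat n n"
    by (auto simp: B_def A_def matrix_of_endo_def form_matrix_def)
  let ?P = "l \<cdot>\<^sub>m A + m \<cdot>\<^sub>m transpose_mat A"
  have P: "?P \<in> carrier_mat n n" using A by simp
  have AF: "form_matrix n e (G \<circ> \<phi>) = transpose_mat B * A * B"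
    using form_matrix_comp[OF b G mult] by (simp add: A_def B_def)
  have "transpose_mat (transpose_mat B * A * B) = transpose_mat B * transpose_mat A * B"
    using A B by (simp add: transpose_mult[of _ n n _ n] assoc_mult_mat[of _ n n _ n _ n])
  moreover have "transpose_mat B * ?P * B
    = l \<cdot>\<^sub>m (transpose_mat B * A * B) + m \<cdot>\<^sub>m (transpose_mat B * transpose_mat A * B)"
    using A B by (simp add: mult_add_distrib_mat[of _ n n _ n] add_mult_distrib_mat[of _ n n _ _ n]
        mult_smult_distrib[of _ n n _ n] mult_smult_assoc_mat[of _ n n _ n])
  ultimately have "char_fun n e l m (G \<circ> \<phi>) = det (transpose_mat B * ?P * B)"
    by (simp add: char_fun_def AF)
  also have "\<dots> = (det B)\<^sup>2 * det ?P"
    using B P by (simp add: det_mult[of _ n] det_transpose power2_eq_square)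
  finally show ?thesis by (simp add: char_fun_def A_def B_def)
qed

end

theorem theorem4:
  fixes scale :: "complex \<Rightarrow> 'a \<Rightarrow> 'a::{ring, monoid_mult}"
    and e :: "nat \<Rightarrow> 'a" and n :: nat
    and F :: "'a \<Rightarrow> complex" and g :: 'a and l m :: complex
  assumes "fd_complex_algebra scale"
    and "is_basis scale n e"
    and "invertible_elem g"
    and "Vector_Spaces.linear scale (*) F"
  shows "char_fun n e l m (coAd g F) = (endo_det scale (Ad g)) powi (-2) * char_fun n e l m F"
proof -
  interpret fd_complex_algebra scale by (rule assms(1))
  interpret F: Vector_Spaces.linear scale "(*)" F by (rule assms(4))
  note b = assms(2)
  obtain h where h: "g * h = 1" "h * g = 1" using assms(3) by (auto simp: invertible_elem_def)
  have inv: "inverse_elem g = h" "inverse_elem h = g" using h by (auto intro: inverse_elem_eq)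
  have cancel: "g * (h * x) = x" "h * (g * x) = x" for x
    using h by (simp_all add: mult.assoc[symmetric])
  have "Vector_Spaces.linear scale (*) (coAd g F)"
    by unfold_locales
      (simp_all add: coAd_def distrib_left distrib_right F.add F.scale mult_scale_left mult_scale_right)
  moreover have "Ad g (x * y) = Ad g x * Ad g y" for x y
    by (simp add: Ad_def inv mult.assoc cancel)
  moreover have "coAd g F \<circ> Ad g = F"
    by (rule ext) (simp add: coAd_def Ad_def inv mult.assoc cancel h)
  moreover have "endo_det scale (Ad g) = det (matrix_of_endo scale n e (Ad g))"
    by (rule endo_det_eq[OF b linear_Ad])
  ultimately have *: "char_fun n e l m F = (endo_det scale (Ad g))\<^sup>2 * char_fun n e l m (coAd g F)"
    using char_fun_comp[OF b, of "coAd g F" "Ad g" l m] by simp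
  have "Ad h \<circ> Ad g = id"
    by (rule ext) (simp add: Ad_def inv mult.assoc cancel h)
  then have "matrix_of_endo scale n e (Ad h) * matrix_of_endo scale n e (Ad g) = 1\<^sub>m n"
    using matrix_of_endo_comp[OF b linear_Ad, of h "Ad g"] matrix_of_endo_id[OF b] by simp
  moreover have "matrix_of_endo scale n e f \<in> carrier_mat n n" for f
    by (simp add: matrix_of_endo_def)
  ultimately have "det (matrix_of_endo scale n e (Ad h)) * det (matrix_of_endo scale n e (Ad g)) = 1"
    by (metis det_mult det_one)
  then have "endo_det scale (Ad g) \<noteq> 0"
    using endo_det_eq[OF b linear_Ad, of g] by auto
  then show ?thesis by (simp add: * power_int_minus)
qed

end
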